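(* Let $k$ be an algebraically closed field of characteristic $0$, let $R=k\langle x,y\rangle/(xy-yx-y^2)$, and let $\rho_n:R\to M_n(k)$ be an $n$-dimensional representation of $R$, $n\geq 1$. Then the image algebra $A=\rho_n(R)$ is basic: its semisimple part is a direct sum of $r$ copies of the field $k$, where $r$ is the number of different eigenvalues of $X=\rho_n(x)$.
   Context: A representation is a unital $k$-algebra homomorphism $R\to M_n(k)$. The semisimple part of a finite-dimensional algebra $A$ is $A/J(A)$, where $J(A)$ is the Jacobson radical. *)

theory Defs
  imports
    "HOL-Algebra.QuotRing"
    "HOL-Algebra.Module"
    "HOL-Library.FuncSet"
    "HOL-Library.Poly_Mapping"
    "Jordan_Normal_Form.Spectral_Radius"
begin

text \<open>
  The records \<^typ>\<open>('k, 'a) module\<close> carry a multiplication as well as a scalar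
  multiplication; they serve here as associative unital algebras, not necessarily commutative,
  over the field given by the type \<open>'k\<close>. The constant \<^const>\<open>module_mat\<close> is of this kind
  and \<^term>\<open>module_mat TYPE('k::field) n n\<close> is the algebra of $n \times n$ matrices.
\<close>

section \<open>Algebras, quotients, homomorphisms\<close>

text \<open>Qualified because the unqualified name is also that of a locale on type-class rings.\<close>
definition algebra_hom ::
  "('k, 'a, 'm) module_scheme \<Rightarrow> ('k, 'b, 'n) module_scheme \<Rightarrow> ('a \<Rightarrow> 'b) set" where
  "algebra_hom A B = {h \<in> Ring.ring_hom A B.
     \<forall>c. \<forall>a \<in> carrier A. h (c \<odot>\<^bsub>A\<^esub> a) = c \<odot>\<^bsub>B\<^esub> h a}"

definition algebra_isomorphic ::
  "('k, 'a, 'm) module_scheme \<Rightarrow> ('k, 'b, 'n) module_scheme \<Rightarrow> bool" where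
  "algebra_isomorphic A B \<longleftrightarrow> (\<exists>h \<in> algebra_hom A B. bij_betw h (carrier A) (carrier B))"

text \<open>The ring \<^term>\<open>A Quot I\<close>, with $c (I + a) = I + c a$.\<close>
definition quotient_algebra ::
  "('k, 'a, 'm) module_scheme \<Rightarrow> 'a set \<Rightarrow> ('k, 'a set) module" where
  "quotient_algebra A I =
     \<lparr>carrier = carrier (A Quot I), monoid.mult = monoid.mult (A Quot I), one = one (A Quot I),
      zero = zero (A Quot I), add = add (A Quot I),
      smult = (\<lambda>c X. \<Union>a \<in> X. I +>\<^bsub>A\<^esub> (c \<odot>\<^bsub>A\<^esub> a))\<rparr>"

definition image_algebra ::
  "('k, 'a, 'm) module_scheme \<Rightarrow> ('k, 'b) module \<Rightarrow> ('a \<Rightarrow> 'b) \<Rightarrow> ('k, 'b) module" where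
  "image_algebra A B h = B\<lparr>carrier := h ` carrier A\<rparr>"

definition representations ::
  "('k::field, 'a, 'm) module_scheme \<Rightarrow> nat \<Rightarrow> ('a \<Rightarrow> 'k mat) set" where
  "representations A n = algebra_hom A (module_mat TYPE('k) n n)"

text \<open>$k^r$ with componentwise operations.\<close>
definition power_algebra :: "nat \<Rightarrow> ('k::field, nat \<Rightarrow> 'k) module" where
  "power_algebra r =
     \<lparr>carrier = {..<r} \<rightarrow>\<^sub>E UNIV,
      monoid.mult = (\<lambda>f g. \<lambda>i\<in>{..<r}. f i * g i), one = (\<lambda>i\<in>{..<r}. 1),
      zero = (\<lambda>i\<in>{..<r}. 0), add = (\<lambda>f g. \<lambda>i\<in>{..<r}. f i + g i),
      smult = (\<lambda>c f. \<lambda>i\<in>{..<r}. c * f i)\<rparr>"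

section \<open>Jacobson radical and basic algebras\<close>

definition left_ideal :: "'a set \<Rightarrow> ('a, 'm) ring_scheme \<Rightarrow> bool" where
  "left_ideal I A \<longleftrightarrow>
     additive_subgroup I A \<and> (\<forall>a \<in> carrier A. \<forall>x \<in> I. a \<otimes>\<^bsub>A\<^esub> x \<in> I)"

definition maximal_left_ideal :: "'a set \<Rightarrow> ('a, 'm) ring_scheme \<Rightarrow> bool" where
  "maximal_left_ideal I A \<longleftrightarrow> left_ideal I A \<and> I \<noteq> carrier A \<and>
     (\<forall>L. left_ideal L A \<and> I \<subseteq> L \<longrightarrow> L = I \<or> L = carrier A)"

definition jacobson_radical :: "('a, 'm) ring_scheme \<Rightarrow> 'a set" where
  "jacobson_radical A = {a \<in> carrier A. \<forall>I. maximal_left_ideal I A \<longrightarrow> a \<in> I}"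

definition semisimple_part :: "('k, 'a, 'm) module_scheme \<Rightarrow> ('k, 'a set) module" where
  "semisimple_part A = quotient_algebra A (jacobson_radical A)"

text \<open>Over an algebraically closed field, a finite-dimensional algebra is basic when its
  semisimple part is a direct sum of copies of the field.\<close>
definition basic_algebra :: "('k::alg_closed_field, 'a, 'm) module_scheme \<Rightarrow> bool" where
  "basic_algebra A \<longleftrightarrow> (\<exists>r. algebra_isomorphic (semisimple_part A) (power_algebra r))"

section \<open>Free algebras\<close>

datatype 'g free_monoid = Word "'g list"

text \<open>Concatenation is written additively so that multiplication in
  \<^typ>\<open>'g free_monoid \<Rightarrow>\<^sub>0 'k\<close> is that of the monoid algebra.\<close>
instantiation free_monoid :: (type) monoid_add
begin

definition "0 = Word []"

fun plus_free_monoid :: "'a free_monoid \<Rightarrow> 'a free_monoid \<Rightarrow> 'a free_monoid" where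
  "Word u + Word v = Word (u @ v)"

instance
proof
  fix a b c :: "'a free_monoid"
  show "a + b + c = a + (b + c)" by (cases a; cases b; cases c) simp
  show "0 + a = a" by (cases a) (simp add: zero_free_monoid_def)
  show "a + 0 = a" by (cases a) (simp add: zero_free_monoid_def)
qed

end

definition free_algebra :: "('k::field, 'g free_monoid \<Rightarrow>\<^sub>0 'k) module" where
  "free_algebra =
     \<lparr>carrier = UNIV, monoid.mult = (*), one = 1, zero = 0, add = (+),
      smult = (\<lambda>c p. Poly_Mapping.single 0 c * p)\<rparr>"

definition free_gen :: "'g \<Rightarrow> ('g free_monoid \<Rightarrow>\<^sub>0 'k::field)" where
  "free_gen g = Poly_Mapping.single (Word [g]) 1"

section \<open>The algebra $k\langle x, y\rangle / (xy - yx - y^2)$\<close>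

datatype xy = GenX | GenY

definition jordan_ideal :: "(xy free_monoid \<Rightarrow>\<^sub>0 'k::field) set" where
  "jordan_ideal = Idl\<^bsub>free_algebra\<^esub>
     {free_gen GenX * free_gen GenY - free_gen GenY * free_gen GenX - free_gen GenY ^ 2}"

definition jordan_algebra :: "('k::field, (xy free_monoid \<Rightarrow>\<^sub>0 'k) set) module" where
  "jordan_algebra = quotient_algebra free_algebra jordan_ideal"

definition jordan_x :: "(xy free_monoid \<Rightarrow>\<^sub>0 'k::field) set" where
  "jordan_x = jordan_ideal +>\<^bsub>free_algebra :: ('k, xy free_monoid \<Rightarrow>\<^sub>0 'k) module\<^esub> free_gen GenX"

end

theory Submission
  imports Defs "HOL-Algebra.Subrings"
begin

text \<open>Write $X$ and $Y$ for the images of $x$ and $y$. The relation says that the derivation $[X, -]$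
  sends $Y$ to $Y^2$, hence $f(Y)$ to $f'(Y) Y^2$. So the minimal polynomial $f$ of $Y$ divides
  $t^2 f'$, and comparing multiplicities of roots in characteristic $0$ leaves $0$ as the only
  root: $Y$ is nilpotent (\<open>y_nilpotent\<close>). The relation also gives $YX = (X - Y)Y$, so $AY$ is
  closed under multiplication from both sides, and it is nil because $Y$ is nilpotent
  (\<open>y_ideal_nil\<close>).

  Since $X$ and $Y$ generate, $A = k[X] + AY$. For an eigenvalue $c$ of $X$ the rule
  $p(X) + bY \mapsto p(c)$ is a well-defined character of $A$: if $p(X)$ lies in $AY$ it is
  nilpotent, so some power of $p$ is divisible by the minimal polynomial of $X$ and $p(c) = 0$
  (\<open>char_val_eqI\<close>). The characters of all $r$ eigenvalues together map $A$ onto $k^r$, by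
  interpolation. If $p(X) + bY$ is in the kernel, then $p$ vanishes on the spectrum, so $p(X)$ is
  nilpotent, and the element is nilpotent modulo the nil ideal $AY$ (\<open>char_val_nil\<close>).

  A homomorphism onto $k^r$ with nil kernel has the Jacobson radical as kernel
  (\<open>jacobson_radical_eq_kernel\<close>): its coordinates have maximal left ideals as kernels, while a nil
  ideal lies in every maximal left ideal. This identifies $A/J(A)$ with $k^r$.

  The computations take place in the ring $k\langle x, y\rangle$, whose multiplication is that of a
  type class, and modulo the kernel of the map to matrices; $A$ is the quotient by that kernel.\<close>

section \<open>Roots of polynomials in one variable\<close>

text \<open>The Nullstellensatz in one variable: split off one linear factor of \<open>f\<close> at a time.\<close>
lemma dvd_power_if_roots_subset:
  fixes f p :: "'k::alg_closed_field poly"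
  assumes "f \<noteq> 0" and "\<And>c. poly f c = 0 \<Longrightarrow> poly p c = 0"
  shows "\<exists>m. f dvd p ^ m"
  using assms
proof (induction "degree f" arbitrary: f rule: less_induct)
  case less
  show ?case
  proof (cases "degree f = 0")
    case True
    with less.prems(1) have "f dvd 1" by (simp add: is_unit_iff_degree)
    then show ?thesis by (intro exI[of _ 0]) simp
  next
    case False
    then obtain c where c: "poly f c = 0" using alg_closed_imp_poly_has_root[of f] by auto
    then obtain g where g: "f = [:- c, 1:] * g" by (auto simp: poly_eq_0_iff_dvd)
    have "g \<noteq> 0" using less.prems(1) g by auto
    then have "degree g < degree f" unfolding g by (subst degree_mult_eq) auto
    then obtain m where "g dvd p ^ m" using less.hyps[of g] less.prems(2) \<open>g \<noteq> 0\<close> g by auto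
    moreover have "[:- c, 1:] dvd p" using less.prems(2)[OF c] by (simp add: poly_eq_0_iff_dvd)
    ultimately have "f dvd p ^ Suc m" unfolding g power_Suc by (rule mult_dvd_mono[rotated])
    then show ?thesis ..
  qed
qed

text \<open>Newton's form of interpolation: a new node is met by adding a multiple of the polynomial
  vanishing at the old ones.\<close>
lemma interpolating_poly:
  fixes g :: "'k::field \<Rightarrow> 'k"
  assumes "finite S"
  shows "\<exists>p. \<forall>s\<in>S. poly p s = g s"
  using assms
proof (induction S)
  case (insert a S)
  then obtain p where p: "\<forall>s\<in>S. poly p s = g s" by blast
  define w where "w = (\<Prod>s\<in>S. [:- s, 1:])"
  have w: "poly w s = 0 \<longleftrightarrow> s \<in> S" for s
    using insert.hyps(1) by (simp add: w_def poly_prod)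
  have "poly (p + Polynomial.smult ((g a - poly p a) / poly w a) w) s = g s" if "s \<in> insert a S" for s
    using that p w insert.hyps(2) by auto
  then show ?case by blast
qed simp

text \<open>In characteristic $0$ a derivative has each root with multiplicity one less, and the factor
  $t^2$ can make up for this only at $0$.\<close>
lemma dvd_pderiv_imp_root_0:
  fixes f :: "'k::field_char_0 poly"
  assumes "f \<noteq> 0" and "f dvd pderiv f * [:0, 1:] ^ 2" and root: "poly f c = 0"
  shows "c = 0"
proof (rule ccontr)
  assume "c \<noteq> 0"
  have ne: "pderiv f \<noteq> 0"
    using assms(1) root by (metis pderiv_eq_0_iff degree_eq_zeroE poly_const_conv pCons_0_0)
  have "order c ([:0, 1:] ^ 2) = 0" using \<open>c \<noteq> 0\<close> by (intro order_0I) simp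
  then have "order c (pderiv f * [:0, 1:] ^ 2) = order c (pderiv f)"
    using ne by (subst order_mult) auto
  moreover have "order c f \<le> order c (pderiv f * [:0, 1:] ^ 2)"
    using assms(2) ne by (intro dvd_imp_order_le) auto
  ultimately show False using order_pderiv[OF assms(1) root] by simp
qed

section \<open>Evaluating polynomials modulo an ideal\<close>

locale central_scalars =
  fixes \<kappa> :: "'k::field \<Rightarrow> 'a::ring_1"
  assumes \<kappa>_add: "\<kappa> (c + d) = \<kappa> c + \<kappa> d"
    and \<kappa>_mult: "\<kappa> (c * d) = \<kappa> c * \<kappa> d"
    and \<kappa>_1: "\<kappa> 1 = 1"
    and \<kappa>_central: "a * \<kappa> c = \<kappa> c * a"
begin

lemma \<kappa>_0: "\<kappa> 0 = 0"
  using \<kappa>_add[of 0 0] by simp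

lemma \<kappa>_uminus: "\<kappa> (- c) = - \<kappa> c"
  using \<kappa>_add[of c "- c"] by (simp add: \<kappa>_0 eq_neg_iff_add_eq_0 add.commute)

definition peval :: "'a \<Rightarrow> 'k poly \<Rightarrow> 'a" where
  "peval z p = fold_coeffs (\<lambda>c s. \<kappa> c + z * s) p 0"

lemma peval_0 [simp]: "peval z 0 = 0"
  by (simp add: peval_def)

lemma peval_pCons [simp]: "peval z (pCons c p) = \<kappa> c + z * peval z p"
  by (cases "p = 0"; cases "c = 0") (simp_all add: peval_def \<kappa>_0)

lemma peval_add: "peval z (p + q) = peval z p + peval z q"
  by (induction p q rule: poly_induct2) (simp_all add: \<kappa>_add algebra_simps)

lemma peval_smult: "peval z (Polynomial.smult c p) = \<kappa> c * peval z p"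
proof (induction p)
  case (pCons a p)
  have "z * (\<kappa> c * peval z p) = \<kappa> c * (z * peval z p)"
    by (metis \<kappa>_central mult.assoc)
  then show ?case using pCons.IH by (simp add: \<kappa>_mult \<kappa>_central[of "\<kappa> a"] algebra_simps)
qed simp

lemma peval_mult: "peval z (p * q) = peval z p * peval z q"
  by (induction p) (simp_all add: peval_add peval_smult \<kappa>_0 algebra_simps)

lemma peval_1 [simp]: "peval z 1 = 1"
  by (simp add: one_pCons \<kappa>_1)

lemma peval_power: "peval z (p ^ m) = peval z p ^ m"
  by (induction m) (simp_all add: peval_mult)

lemma peval_uminus: "peval z (- p) = - peval z p"
  using peval_add[of z p "- p"] by (simp add: eq_neg_iff_add_eq_0 add.commute)

lemma peval_diff: "peval z (p - q) = peval z p - peval z q"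
  using peval_add[of z p "- q"] by (simp add: peval_uminus)

lemma peval_monom: "peval z (Polynomial.monom c j) = \<kappa> c * z ^ j"
  by (induction j)
     (simp_all add: Polynomial.monom_0 Polynomial.monom_Suc \<kappa>_0 mult.assoc[symmetric] \<kappa>_central)

lemma peval_sum: "peval z (\<Sum>i\<in>S. p i) = (\<Sum>i\<in>S. peval z (p i))"
  by (induction S rule: infinite_finite_induct) (simp_all add: peval_add)

end

text \<open>Congruence of \<open>a\<close> and \<open>b\<close> modulo \<open>K\<close> is written as \<open>a - b \<in> K\<close>, so that all calculations stay
  in the ring instead of a quotient.\<close>
locale two_sided_ideal = central_scalars \<kappa> for \<kappa> :: "'k::field \<Rightarrow> 'a::ring_1" +
  fixes K :: "'a set"
  assumes zero_mem: "0 \<in> K"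
    and add_mem: "a \<in> K \<Longrightarrow> b \<in> K \<Longrightarrow> a + b \<in> K"
    and mult_left_mem: "a \<in> K \<Longrightarrow> b * a \<in> K"
    and mult_right_mem: "a \<in> K \<Longrightarrow> a * b \<in> K"
begin

lemma uminus_mem: "a \<in> K \<Longrightarrow> - a \<in> K"
  using mult_left_mem[of a "- 1"] by simp

lemma diff_mem: "a \<in> K \<Longrightarrow> b \<in> K \<Longrightarrow> a - b \<in> K"
  using add_mem[of a "- b"] uminus_mem by simp

lemma mem_cong: "a - b \<in> K \<Longrightarrow> a \<in> K \<longleftrightarrow> b \<in> K"
  using add_mem[of "a - b" b] diff_mem[of a "a - b"] by auto

lemma mult_cong:
  assumes "a - a' \<in> K" and "b - b' \<in> K"
  shows "a * b - a' * b' \<in> K"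
proof -
  have "a * b - a' * b' = (a - a') * b + a' * (b - b')" by (simp add: algebra_simps)
  then show ?thesis using assms add_mem mult_left_mem mult_right_mem by metis
qed

lemma power_cong: "a - b \<in> K \<Longrightarrow> a ^ m - b ^ m \<in> K"
  by (induction m) (auto simp: zero_mem mult_cong)

lemma cong_trans: "a - b \<in> K \<Longrightarrow> b - c \<in> K \<Longrightarrow> a - c \<in> K"
  using add_mem[of "a - b" "b - c"] by simp

text \<open>The polynomials that kill \<open>z\<close> modulo \<open>K\<close> form an ideal; division with remainder makes an element
  of least degree a generator.\<close>
lemma min_poly_exists:
  assumes "\<exists>p. p \<noteq> 0 \<and> peval z p \<in> K"
  shows "\<exists>f. f \<noteq> 0 \<and> (\<forall>p. peval z p \<in> K \<longleftrightarrow> f dvd p)"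
proof -
  define f where "f = arg_min degree (\<lambda>p. p \<noteq> 0 \<and> peval z p \<in> K)"
  have f: "f \<noteq> 0" "peval z f \<in> K"
    using arg_min_natI[of "\<lambda>p. p \<noteq> 0 \<and> peval z p \<in> K"] assms unfolding f_def by auto
  have min: "degree f \<le> degree p" if "p \<noteq> 0" "peval z p \<in> K" for p
    unfolding f_def using that by (intro arg_min_nat_le) auto
  have "f dvd p" if "peval z p \<in> K" for p
  proof (rule ccontr)
    assume "\<not> f dvd p"
    then have r: "p mod f \<noteq> 0" by (simp add: dvd_eq_mod_eq_0)
    have "p mod f = p - p div f * f" by (rule minus_div_mult_eq_mod[symmetric])
    then have "peval z (p mod f) = peval z p - peval z (p div f) * peval z f"
      by (simp add: peval_diff peval_mult)
    then have "peval z (p mod f) \<in> K" using that f(2) diff_mem mult_left_mem by simp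
    then show False using min[OF r] degree_mod_less'[OF f(1) r] by simp
  qed
  then show ?thesis using f by (intro exI[of _ f]) (auto simp: dvd_def peval_mult mult_right_mem)
qed

definition min_poly :: "'a \<Rightarrow> 'k poly" where
  "min_poly z = (SOME f. f \<noteq> 0 \<and> (\<forall>p. peval z p \<in> K \<longleftrightarrow> f dvd p))"

end

locale algebraic_quotient = two_sided_ideal \<kappa> K
  for \<kappa> :: "'k::{alg_closed_field, field_char_0} \<Rightarrow> 'a::ring_1" and K +
  assumes algebraic: "\<exists>p. p \<noteq> 0 \<and> peval z p \<in> K"
begin

lemma min_poly_nz: "min_poly z \<noteq> 0"
  and peval_mem_iff: "peval z p \<in> K \<longleftrightarrow> min_poly z dvd p"
  using someI_ex[OF min_poly_exists[OF algebraic[of z]]] unfolding min_poly_def by blast+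

lemma peval_power_mem:
  assumes "\<And>c. poly (min_poly z) c = 0 \<Longrightarrow> poly p c = 0"
  shows "\<exists>m. peval z p ^ m \<in> K"
  using dvd_power_if_roots_subset[OF min_poly_nz assms]
  by (auto simp: peval_power[symmetric] peval_mem_iff)

lemma poly_root_if_peval_power_mem:
  assumes "peval z p ^ m \<in> K" and "poly (min_poly z) c = 0"
  shows "poly p c = 0"
proof -
  have "[:- c, 1:] dvd p ^ m"
    using assms by (auto simp: peval_power[symmetric] peval_mem_iff poly_eq_0_iff_dvd intro: dvd_trans)
  then have "poly p c ^ m = 0" by (simp add: poly_eq_0_iff_dvd[symmetric])
  then show ?thesis by simp
qed

end

section \<open>The relation $xy - yx = y^2$\<close>

text \<open>The last assumption is the induction principle saying that the scalars, \<open>x\<close> and \<open>y\<close> generate the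
  ring.\<close>
locale jordan_relation = algebraic_quotient \<kappa> K
  for \<kappa> :: "'k::{alg_closed_field, field_char_0} \<Rightarrow> 'a::ring_1" and K +
  fixes x y :: 'a
  assumes relation: "x * y - y * x - y ^ 2 \<in> K"
    and generated: "\<lbrakk>\<And>c. \<kappa> c \<in> S; x \<in> S; y \<in> S; \<And>a b. a \<in> S \<Longrightarrow> b \<in> S \<Longrightarrow> a + b \<in> S;
      \<And>a b. a \<in> S \<Longrightarrow> b \<in> S \<Longrightarrow> a * b \<in> S\<rbrakk> \<Longrightarrow> S = UNIV"
begin

lemma peval_y_commute: "peval y p * y = y * peval y p"
  using peval_mult[of y p "[:0, 1:]"] peval_mult[of y "[:0, 1:]" p] by (simp add: \<kappa>_0 \<kappa>_1 mult.commute)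

text \<open>The derivation $[x, -]$ sends $y$ to $y^2$, which commutes with every polynomial in $y$, so the
  chain rule holds.\<close>
lemma commutator_peval: "x * peval y p - peval y p * x - peval y (pderiv p) * y ^ 2 \<in> K"
proof (induction p)
  case (pCons c p)
  let ?P = "peval y p" and ?D = "peval y (pderiv p)"
  have y2: "y * (y * ?P) = ?P * (y * y)"
    by (metis peval_y_commute mult.assoc)
  have "x * peval y (pCons c p) - peval y (pCons c p) * x - peval y (pderiv (pCons c p)) * y ^ 2
      = (x * y - y * x - y ^ 2) * ?P + y * (x * ?P - ?P * x - ?D * y ^ 2)"
    by (simp add: pderiv_pCons peval_add \<kappa>_0 \<kappa>_central algebra_simps y2 power2_eq_square)
  then show ?case using pCons.IH relation add_mem mult_left_mem mult_right_mem by metis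
qed (simp add: zero_mem)

text \<open>For the minimal polynomial $f$ of $y$ both terms of the commutator lie in \<open>K\<close>, hence so does
  $f'(y) y^2$. So $f$ divides $t^2 f'$ and has no root besides $0$.\<close>
lemma y_nilpotent: "\<exists>m. y ^ m \<in> K"
proof -
  let ?f = "min_poly y"
  have f: "peval y ?f \<in> K" by (simp add: peval_mem_iff)
  have "peval y (pderiv ?f) * y ^ 2 \<in> K"
    using commutator_peval[of ?f] f mem_cong[of "x * peval y ?f - peval y ?f * x" "peval y (pderiv ?f) * y ^ 2"]
      diff_mem mult_left_mem mult_right_mem by blast
  then have "peval y (pderiv ?f * [:0, 1:] ^ 2) \<in> K"
    by (simp add: peval_mult peval_power \<kappa>_0 \<kappa>_1)
  then have "poly [:0, 1:] c = 0" if "poly ?f c = 0" for c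
    using that dvd_pderiv_imp_root_0[OF min_poly_nz] by (simp add: peval_mem_iff)
  then have "\<exists>m. peval y [:0, 1:] ^ m \<in> K" by (rule peval_power_mem)
  then show ?thesis by (simp add: \<kappa>_0 \<kappa>_1)
qed

text \<open>Modulo \<open>K\<close> this is the left ideal generated by \<open>y\<close>; it turns out to be two-sided.\<close>
definition y_ideal :: "'a set" where
  "y_ideal = {a. \<exists>b. a - b * y \<in> K}"

text \<open>Enough for generators, where it holds because $yx = (x - y)y$ modulo \<open>K\<close>.\<close>
lemma y_mult_swap: "\<exists>b. y * a - b * y \<in> K"
proof -
  let ?S = "{a. \<exists>b. y * a - b * y \<in> K}"
  have "?S = UNIV"
  proof (rule generated)
    show "\<kappa> c \<in> ?S" for c by (auto intro: exI[of _ "\<kappa> c"] simp: \<kappa>_central zero_mem)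
    show "x \<in> ?S" using uminus_mem[OF relation]
      by (auto intro!: exI[of _ "x - y"] simp: power2_eq_square algebra_simps)
    show "y \<in> ?S" by (auto intro: exI[of _ y] simp: zero_mem)
  next
    fix a a' assume "a \<in> ?S" "a' \<in> ?S"
    then obtain b b' where b: "y * a - b * y \<in> K" "y * a' - b' * y \<in> K" by auto
    show "a + a' \<in> ?S" using add_mem[OF b] by (auto intro!: exI[of _ "b + b'"] simp: algebra_simps)
    have "y * a * a' - b * y * a' \<in> K" "b * (y * a') - b * (b' * y) \<in> K"
      using mult_right_mem[OF b(1), of a'] mult_left_mem[OF b(2), of b] by (simp_all add: algebra_simps)
    then have "y * (a * a') - b * b' * y \<in> K"
      using add_mem[of "y * a * a' - b * y * a'" "b * (y * a') - b * (b' * y)"] by (simp add: algebra_simps)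
    then show "a * a' \<in> ?S" by auto
  qed
  then show ?thesis by blast
qed

lemma y_power_mult_swap: "\<exists>b. y ^ m * a - b * y ^ m \<in> K"
proof (induction m arbitrary: a)
  case 0
  show ?case by (auto intro: exI[of _ a] simp: zero_mem)
next
  case (Suc m)
  obtain b where b: "y * a - b * y \<in> K" using y_mult_swap by blast
  obtain d where d: "y ^ m * b - d * y ^ m \<in> K" using Suc.IH by blast
  have "y ^ Suc m * a - d * y ^ Suc m = y ^ m * (y * a - b * y) + (y ^ m * b - d * y ^ m) * y"
    by (simp del: power_Suc add: power_Suc2 algebra_simps)
  then show ?case using mult_left_mem[OF b, of "y ^ m"] mult_right_mem[OF d, of y] add_mem by metis
qed

sublocale y_ideal: two_sided_ideal \<kappa> y_ideal
proof
  show "0 \<in> y_ideal" by (auto simp: y_ideal_def zero_mem intro: exI[of _ 0])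
next
  fix a a' assume "a \<in> y_ideal" "a' \<in> y_ideal"
  then obtain b b' where "a - b * y \<in> K" "a' - b' * y \<in> K" by (auto simp: y_ideal_def)
  then have "(a - b * y) + (a' - b' * y) \<in> K" by (rule add_mem)
  then show "a + a' \<in> y_ideal" by (auto simp: y_ideal_def algebra_simps intro!: exI[of _ "b + b'"])
next
  fix a c assume "a \<in> y_ideal"
  then obtain b where b: "a - b * y \<in> K" by (auto simp: y_ideal_def)
  then show "c * a \<in> y_ideal"
    using mult_left_mem[OF b, of c] by (auto simp: y_ideal_def algebra_simps intro!: exI[of _ "c * b"])
  obtain d where d: "y * c - d * y \<in> K" using y_mult_swap by blast
  have "a * c - b * d * y = (a - b * y) * c + b * (y * c - d * y)" by (simp add: algebra_simps)
  then have "a * c - b * d * y \<in> K" using mult_right_mem[OF b, of c] mult_left_mem[OF d, of b] add_mem by metis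
  then show "a * c \<in> y_ideal" by (auto simp: y_ideal_def)
qed

lemma y_ideal_supset: "a \<in> K \<Longrightarrow> a \<in> y_ideal"
  by (auto simp: y_ideal_def intro: exI[of _ 0])

text \<open>Moving every \<open>y\<close> to the right shows that the \<open>j\<close>-th power of \<open>b * y\<close> is a left multiple of
  \<open>y ^ j\<close>.\<close>
lemma y_ideal_nil:
  assumes "a \<in> y_ideal"
  shows "\<exists>m. a ^ m \<in> K"
proof -
  obtain b where b: "a - b * y \<in> K" using assms by (auto simp: y_ideal_def)
  obtain m where m: "y ^ m \<in> K" using y_nilpotent by blast
  have "\<exists>d. a ^ j - d * y ^ j \<in> K" for j
  proof (induction j)
    case (Suc j)
    then obtain d where d: "a ^ j - d * y ^ j \<in> K" by blast
    obtain e where e: "y ^ j * b - e * y ^ j \<in> K" using y_power_mult_swap by blast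
    have "a * a ^ j - (d * y ^ j) * (b * y) \<in> K"
      using mult_cong[OF d b] by (simp add: power_commutes)
    moreover have "(d * y ^ j) * (b * y) - d * e * y ^ Suc j = d * (y ^ j * b - e * y ^ j) * y"
      by (simp add: algebra_simps power_commutes)
    then have "(d * y ^ j) * (b * y) - d * e * y ^ Suc j \<in> K"
      using mult_right_mem[OF mult_left_mem[OF e, of d], of y] by simp
    ultimately have "a ^ Suc j - d * e * y ^ Suc j \<in> K" using cong_trans by simp
    then show ?case by blast
  qed (auto simp: zero_mem intro: exI[of _ 1])
  then obtain d where "a ^ m - d * y ^ m \<in> K" by blast
  then show ?thesis using mem_cong mult_left_mem[OF m] by blast
qed

lemma poly_in_x_exists: "\<exists>p. a - peval x p \<in> y_ideal"
proof -
  let ?S = "{a. \<exists>p. a - peval x p \<in> y_ideal}"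
  have "?S = UNIV"
  proof (rule generated)
    show "\<kappa> c \<in> ?S" for c by (auto intro!: exI[of _ "[:c:]"] y_ideal.zero_mem)
    show "x \<in> ?S" by (auto intro!: exI[of _ "[:0, 1:]"] y_ideal.zero_mem simp: \<kappa>_0 \<kappa>_1)
    show "y \<in> ?S" by (auto intro!: exI[of _ "0 :: 'k poly"] exI[of _ "1 :: 'a"] zero_mem simp: y_ideal_def)
  next
    fix a b assume "a \<in> ?S" "b \<in> ?S"
    then obtain p q where pq: "a - peval x p \<in> y_ideal" "b - peval x q \<in> y_ideal" by auto
    show "a + b \<in> ?S" using y_ideal.add_mem[OF pq]
      by (auto intro!: exI[of _ "p + q"] simp: peval_add algebra_simps)
    show "a * b \<in> ?S" using y_ideal.mult_cong[OF pq] by (auto intro!: exI[of _ "p * q"] simp: peval_mult)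
  qed
  then show ?thesis by blast
qed

text \<open>The character that sends \<open>x\<close> to \<open>c\<close> and \<open>y\<close> to \<open>0\<close>. The choice of \<open>p\<close> is harmless only when \<open>c\<close> is a root
  of the minimal polynomial of \<open>x\<close>.\<close>
definition char_val :: "'k \<Rightarrow> 'a \<Rightarrow> 'k" where
  "char_val c a = poly (SOME p. a - peval x p \<in> y_ideal) c"

text \<open>Two candidates differ by a polynomial whose value at \<open>x\<close> lies in the nil ideal \<open>y_ideal\<close>; a
  polynomial that is nilpotent at \<open>x\<close> vanishes at the roots of the minimal polynomial.\<close>
lemma char_val_eqI:
  assumes root: "poly (min_poly x) c = 0" and p: "a - peval x p \<in> y_ideal"
  shows "char_val c a = poly p c"
proof -
  define q where "q = (SOME p. a - peval x p \<in> y_ideal)"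
  have q: "a - peval x q \<in> y_ideal" unfolding q_def using someI_ex[OF poly_in_x_exists] .
  have "peval x (q - p) \<in> y_ideal" using y_ideal.diff_mem[OF p q] by (simp add: peval_diff)
  then obtain m where "peval x (q - p) ^ m \<in> K" using y_ideal_nil by blast
  then have "poly (q - p) c = 0" using root by (rule poly_root_if_peval_power_mem)
  then show ?thesis unfolding char_val_def q_def[symmetric] by simp
qed

lemma
  assumes "poly (min_poly x) c = 0"
  shows char_val_add: "char_val c (a + b) = char_val c a + char_val c b"
    and char_val_mult: "char_val c (a * b) = char_val c a * char_val c b"
    and char_val_\<kappa>: "char_val c (\<kappa> d) = d"
    and char_val_peval: "char_val c (peval x p) = poly p c"
    and char_val_K: "a \<in> K \<Longrightarrow> char_val c a = 0"
proof -
  obtain p q where pq: "a - peval x p \<in> y_ideal" "b - peval x q \<in> y_ideal"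
    using poly_in_x_exists by blast
  have "a + b - peval x (p + q) \<in> y_ideal"
    using y_ideal.add_mem[OF pq] by (simp add: peval_add algebra_simps)
  then show "char_val c (a + b) = char_val c a + char_val c b"
    using pq by (simp add: char_val_eqI[OF assms])
  have "a * b - peval x (p * q) \<in> y_ideal"
    using y_ideal.mult_cong[OF pq] by (simp add: peval_mult)
  then show "char_val c (a * b) = char_val c a * char_val c b"
    using pq by (simp add: char_val_eqI[OF assms])
  show ev: "char_val c (peval x p) = poly p c" for p
    by (rule char_val_eqI[OF assms]) (simp add: y_ideal.zero_mem)
  show "char_val c (\<kappa> d) = d" using ev[of "[:d:]"] by simp
  show "char_val c a = 0" if "a \<in> K"
    using char_val_eqI[OF assms, of a 0] y_ideal_supset[OF that] by simp
qed

text \<open>If \<open>a\<close> is congruent to $p(x)$ modulo \<open>y_ideal\<close>, then $p$ vanishes at all roots of the minimal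
  polynomial, so $p(x)$ is nilpotent, and \<open>a\<close> is nilpotent in two stages: first modulo \<open>y_ideal\<close>,
  then modulo \<open>K\<close>.\<close>
lemma char_val_nil:
  assumes "\<And>c. poly (min_poly x) c = 0 \<Longrightarrow> char_val c a = 0"
  shows "\<exists>m. a ^ m \<in> K"
proof -
  obtain p where p: "a - peval x p \<in> y_ideal" using poly_in_x_exists by blast
  then have "poly p c = 0" if "poly (min_poly x) c = 0" for c
    using assms[OF that] char_val_eqI[OF that p] by simp
  then obtain m where "peval x p ^ m \<in> K" using peval_power_mem by blast
  then have "a ^ m \<in> y_ideal"
    using y_ideal.mem_cong[OF y_ideal.power_cong[OF p]] y_ideal_supset by blast
  then obtain j where "(a ^ m) ^ j \<in> K" using y_ideal_nil by blast
  then show ?thesis by (auto simp: power_mult[symmetric])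
qed

end

section \<open>The Jacobson radical as a nil kernel\<close>

lemma power_algebra_simps [simp]:
  "carrier (power_algebra r) = {..<r} \<rightarrow>\<^sub>E UNIV"
  "f \<otimes>\<^bsub>power_algebra r\<^esub> g = (\<lambda>i\<in>{..<r}. f i * g i)"
  "f \<oplus>\<^bsub>power_algebra r\<^esub> g = (\<lambda>i\<in>{..<r}. f i + g i)"
  "\<one>\<^bsub>power_algebra r\<^esub> = (\<lambda>i\<in>{..<r}. 1)"
  "\<zero>\<^bsub>power_algebra r\<^esub> = (\<lambda>i\<in>{..<r}. 0)"
  "c \<odot>\<^bsub>power_algebra r\<^esub> f = (\<lambda>i\<in>{..<r}. c * f i)"
  by (simp_all add: power_algebra_def)

lemma power_algebra_ring: "ring (power_algebra r :: ('k::field, nat \<Rightarrow> 'k) module)" (is "ring ?P")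
proof (rule ringI)
  show "abelian_group ?P"
  proof (rule abelian_groupI)
    fix f assume "f \<in> carrier ?P"
    then show "\<exists>g\<in>carrier ?P. g \<oplus>\<^bsub>?P\<^esub> f = \<zero>\<^bsub>?P\<^esub>"
      by (intro bexI[of _ "\<lambda>i\<in>{..<r}. - f i"]) (simp_all cong: restrict_cong)
  qed (simp_all add: ac_simps PiE_restrict cong: restrict_cong)
  show "Group.monoid ?P"
    by (rule Group.monoidI) (simp_all add: ac_simps PiE_restrict cong: restrict_cong)
qed (simp_all add: algebra_simps cong: restrict_cong)

lemma left_idealI:
  fixes A (structure)
  assumes "ring A" and "I \<subseteq> carrier A" and "\<zero> \<in> I"
    and "\<And>a b. a \<in> I \<Longrightarrow> b \<in> I \<Longrightarrow> a \<oplus> b \<in> I"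
    and "\<And>a b. a \<in> carrier A \<Longrightarrow> b \<in> I \<Longrightarrow> a \<otimes> b \<in> I"
  shows "left_ideal I A"
proof -
  interpret ring A by fact
  have "\<ominus> b \<in> I" if "b \<in> I" for b
    using assms(5)[of "\<ominus> \<one>" b] that assms(2) by (auto simp: l_minus subsetD)
  then have "subgroup I (add_monoid A)"
    using assms by (intro add.subgroupI) (auto simp: a_inv_def)
  then show ?thesis using assms(5) by (simp add: left_ideal_def additive_subgroup_def)
qed

lemma (in ring) left_ideal_eq_carrier:
  assumes "left_ideal I R" and "\<one> \<in> I"
  shows "I = carrier R"
  using assms additive_subgroup.a_subset[of I R] unfolding left_ideal_def
  by (metis r_one subsetI subset_antisym)

text \<open>The geometric series; for nilpotent \<open>b\<close> it inverts \<open>\<one> \<ominus> b\<close> from the left.\<close>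
lemma (in ring) geometric_inverse:
  assumes b: "b \<in> carrier R"
  shows "\<exists>s\<in>carrier R. s \<otimes> (\<one> \<ominus> b) = \<one> \<ominus> b [^] (m::nat)"
proof (induction m)
  case 0
  show ?case using b by (intro bexI[of _ \<zero>]) (auto simp: minus_eq r_neg)
next
  case (Suc m)
  then obtain s where s: "s \<in> carrier R" "s \<otimes> (\<one> \<ominus> b) = \<one> \<ominus> b [^] m" by blast
  have p: "b [^] m \<in> carrier R" using b by simp
  have "(s \<oplus> b [^] m) \<otimes> (\<one> \<ominus> b) = (\<one> \<ominus> b [^] m) \<oplus> b [^] m \<otimes> (\<one> \<ominus> b)"
    using s b p by (simp add: l_distr)
  also have "\<dots> = \<one> \<ominus> b [^] Suc m"
    using b p by (simp add: minus_eq r_distr r_minus a_assoc r_neg1 r_neg2 l_neg)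
  finally show ?case using s b by (intro bexI[of _ "s \<oplus> b [^] m"]) auto
qed

locale nil_kernel_onto_power = ring A for A (structure) +
  fixes \<theta> :: "'a \<Rightarrow> nat \<Rightarrow> 'k::field" and r :: nat
  assumes hom: "\<theta> \<in> Ring.ring_hom A (power_algebra r)"
    and onto: "\<theta> ` carrier A = carrier (power_algebra r)"
    and nil: "\<lbrakk>a \<in> carrier A; \<theta> a = \<zero>\<^bsub>power_algebra r\<^esub>\<rbrakk> \<Longrightarrow> \<exists>m::nat. a [^] m = \<zero>"
begin

sublocale hom: ring_hom_ring A "power_algebra r" \<theta>
  using ring_axioms power_algebra_ring hom by (rule ring_hom_ringI2)

text \<open>A left ideal that contains this kernel strictly has an element \<open>b\<close> whose \<open>i\<close>-th coordinate is
  invertible. A suitable multiple \<open>c \<otimes> b\<close> has coordinate $1$ and differs from \<open>\<one>\<close> by an element of the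
  kernel.\<close>
lemma coordinate_kernel_maximal:
  assumes i: "i < r"
  shows "maximal_left_ideal {a \<in> carrier A. \<theta> a i = 0} A"
proof -
  let ?M = "{a \<in> carrier A. \<theta> a i = 0}"
  have left: "left_ideal ?M A"
    by (rule left_idealI, rule ring_axioms) (use i in auto)
  have one: "\<theta> \<one> i = 1" using i by simp
  moreover have "L = carrier A" if L: "left_ideal L A" "?M \<subseteq> L" "L \<noteq> ?M" for L
  proof -
    interpret L: additive_subgroup L A using L(1) by (simp add: left_ideal_def)
    obtain b where b: "b \<in> L" "b \<in> carrier A" "\<theta> b i \<noteq> 0" using L(2,3) L.a_subset by blast
    have "(\<lambda>j\<in>{..<r}. inverse (\<theta> b i)) \<in> carrier (power_algebra r)" by simp
    then obtain c where c: "c \<in> carrier A" "\<theta> c = (\<lambda>j\<in>{..<r}. inverse (\<theta> b i))"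
      unfolding onto[symmetric] by auto
    have cb: "c \<otimes> b \<in> carrier A" using b c by simp
    have "\<theta> (\<one> \<ominus> c \<otimes> b) \<oplus>\<^bsub>power_algebra r\<^esub> \<theta> (c \<otimes> b) = \<theta> ((\<one> \<ominus> c \<otimes> b) \<oplus> c \<otimes> b)"
      using cb by (intro hom.hom_add[symmetric]) auto
    also have "(\<one> \<ominus> c \<otimes> b) \<oplus> c \<otimes> b = \<one>" using cb by (simp add: minus_eq a_assoc l_neg)
    finally have *: "\<theta> (\<one> \<ominus> c \<otimes> b) \<oplus>\<^bsub>power_algebra r\<^esub> \<theta> (c \<otimes> b) = \<theta> \<one>" .
    have "\<theta> (\<one> \<ominus> c \<otimes> b) i + \<theta> (c \<otimes> b) i = 1" using fun_cong[OF *, of i] i one by simp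
    moreover have "\<theta> (c \<otimes> b) i = 1" using b c i by simp
    ultimately have "\<one> \<ominus> c \<otimes> b \<in> L" using L(2) cb by auto
    moreover have "c \<otimes> b \<in> L" using L(1) b c by (simp add: left_ideal_def)
    ultimately have "(\<one> \<ominus> c \<otimes> b) \<oplus> c \<otimes> b \<in> L" by simp
    also have "(\<one> \<ominus> c \<otimes> b) \<oplus> c \<otimes> b = \<one>" using cb by (simp add: minus_eq a_assoc l_neg)
    finally show ?thesis using left_ideal_eq_carrier L(1) by blast
  qed
  moreover have "?M \<noteq> carrier A" using one one_closed by force
  ultimately show ?thesis unfolding maximal_left_ideal_def using left by blast
qed

text \<open>Otherwise \<open>I\<close> and \<open>a\<close> together generate the unit ideal, \<open>\<one> = u \<oplus> c \<otimes> a\<close> with \<open>u \<in> I\<close>. The product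
  \<open>c \<otimes> a\<close> is again in the kernel, hence nilpotent, so \<open>u\<close> has a left inverse and \<open>I\<close> is everything.\<close>
lemma kernel_in_maximal:
  assumes I: "maximal_left_ideal I A" and a: "a \<in> carrier A" "\<theta> a = \<zero>\<^bsub>power_algebra r\<^esub>"
  shows "a \<in> I"
proof (rule ccontr)
  assume "a \<notin> I"
  have left: "left_ideal I A" and proper: "I \<noteq> carrier A" using I by (auto simp: maximal_left_ideal_def)
  interpret I: additive_subgroup I A using left by (simp add: left_ideal_def)
  define L where "L = {u \<oplus> c \<otimes> a | u c. u \<in> I \<and> c \<in> carrier A}"
  have "left_ideal L A"
  proof (rule left_idealI, rule ring_axioms)
    show "L \<subseteq> carrier A" using a I.a_subset unfolding L_def by blast
    show "\<zero> \<in> L" unfolding L_def by (intro CollectI exI[of _ \<zero>]) (use a in simp)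
  next
    fix p q assume "p \<in> L" "q \<in> L"
    then obtain u c v d where p: "p = u \<oplus> c \<otimes> a" "u \<in> I" "c \<in> carrier A"
      and q: "q = v \<oplus> d \<otimes> a" "v \<in> I" "d \<in> carrier A" unfolding L_def by blast
    have "p \<oplus> q = (u \<oplus> v) \<oplus> (c \<oplus> d) \<otimes> a"
      using p q a I.a_subset by (simp add: l_distr a_ac subsetD)
    then show "p \<oplus> q \<in> L" unfolding L_def using p q by blast
  next
    fix b p assume b: "b \<in> carrier A" and "p \<in> L"
    then obtain u c where p: "p = u \<oplus> c \<otimes> a" "u \<in> I" "c \<in> carrier A" unfolding L_def by blast
    have "b \<otimes> p = b \<otimes> u \<oplus> (b \<otimes> c) \<otimes> a"
      using p a b I.a_subset by (simp add: r_distr m_assoc subsetD)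
    moreover have "b \<otimes> u \<in> I" using left b p by (simp add: left_ideal_def)
    ultimately show "b \<otimes> p \<in> L" unfolding L_def using p b by blast
  qed
  moreover have "I \<subseteq> L"
  proof
    fix u assume "u \<in> I"
    moreover from this have "u = u \<oplus> \<zero> \<otimes> a" using a I.a_subset by (simp add: subsetD)
    ultimately show "u \<in> L" unfolding L_def by blast
  qed
  moreover have "a \<in> L"
  proof -
    have "a = \<zero> \<oplus> \<one> \<otimes> a" using a by simp
    then show ?thesis unfolding L_def using I.zero_closed by blast
  qed
  ultimately have "L = carrier A" using I \<open>a \<notin> I\<close> by (auto simp: maximal_left_ideal_def)
  then obtain u c where u: "\<one> = u \<oplus> c \<otimes> a" "u \<in> I" "c \<in> carrier A"
    unfolding L_def using one_closed by blast
  have ca: "c \<otimes> a \<in> carrier A" and uc: "u \<in> carrier A" using u a I.a_subset by auto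
  have "\<theta> (c \<otimes> a) = \<zero>\<^bsub>power_algebra r\<^esub>" using u a by (simp del: power_algebra_simps)
  then obtain m :: nat where m: "(c \<otimes> a) [^] m = \<zero>" using nil ca by blast
  obtain s where s: "s \<in> carrier A" "s \<otimes> (\<one> \<ominus> c \<otimes> a) = \<one> \<ominus> (c \<otimes> a) [^] m"
    using geometric_inverse[OF ca] by blast
  have "\<one> \<ominus> c \<otimes> a = u" using ca uc unfolding u(1) by (simp add: minus_eq a_assoc r_neg)
  then have "s \<otimes> u = \<one>" using s m by (simp add: minus_eq)
  moreover have "s \<otimes> u \<in> I" using left s u by (simp add: left_ideal_def)
  ultimately show False using left_ideal_eq_carrier[OF left] proper by simp
qed

text \<open>The kernel of \<open>\<theta>\<close> is the intersection of the maximal left ideals cut out by its \<open>r\<close> coordinates, and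
  lies in all other maximal left ideals as well.\<close>
lemma jacobson_radical_eq_kernel: "jacobson_radical A = a_kernel A (power_algebra r) \<theta>"
proof
  show "a_kernel A (power_algebra r) \<theta> \<subseteq> jacobson_radical A"
    using kernel_in_maximal unfolding jacobson_radical_def a_kernel_def' by blast
  show "jacobson_radical A \<subseteq> a_kernel A (power_algebra r) \<theta>"
  proof
    fix a assume a: "a \<in> jacobson_radical A"
    have i: "\<theta> a i = 0" if "i < r" for i
      using a coordinate_kernel_maximal[OF that] unfolding jacobson_radical_def by blast
    have aA: "a \<in> carrier A" using a by (simp add: jacobson_radical_def)
    then have "\<theta> a \<in> carrier (power_algebra r)" by (rule hom.hom_closed)
    then have "\<theta> a = \<zero>\<^bsub>power_algebra r\<^esub>"
      using i by (intro PiE_ext[of "\<theta> a" "{..<r}" "\<lambda>_. UNIV"]) simp_all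
    then show "a \<in> a_kernel A (power_algebra r) \<theta>" using aA unfolding a_kernel_def' by blast
  qed
qed

end

text \<open>The union that defines scalar multiplication on cosets has all its members equal.\<close>
lemma quotient_algebra_smult:
  assumes "ideal I A" and a: "a \<in> carrier A"
    and closed: "\<And>b. b \<in> carrier A \<Longrightarrow> c \<odot>\<^bsub>A\<^esub> b \<in> carrier A"
    and add: "\<And>b d. b \<in> carrier A \<Longrightarrow> d \<in> carrier A \<Longrightarrow>
      c \<odot>\<^bsub>A\<^esub> (b \<oplus>\<^bsub>A\<^esub> d) = c \<odot>\<^bsub>A\<^esub> b \<oplus>\<^bsub>A\<^esub> c \<odot>\<^bsub>A\<^esub> d"
    and I: "\<And>b. b \<in> I \<Longrightarrow> c \<odot>\<^bsub>A\<^esub> b \<in> I"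
  shows "c \<odot>\<^bsub>quotient_algebra A I\<^esub> (I +>\<^bsub>A\<^esub> a) = I +>\<^bsub>A\<^esub> (c \<odot>\<^bsub>A\<^esub> a)"
proof -
  interpret ideal I A by fact
  have "I +>\<^bsub>A\<^esub> (c \<odot>\<^bsub>A\<^esub> b) = I +>\<^bsub>A\<^esub> (c \<odot>\<^bsub>A\<^esub> a)" if "b \<in> I +>\<^bsub>A\<^esub> a" for b
  proof -
    have "b \<in> (\<Union>d\<in>I. {d \<oplus>\<^bsub>A\<^esub> a})" using that by (simp only: a_r_coset_def')
    then obtain d where "d \<in> I" "b \<in> {d \<oplus>\<^bsub>A\<^esub> a}" by (rule UN_E)
    then have d: "d \<in> I" "b = d \<oplus>\<^bsub>A\<^esub> a" by simp_all
    have dc: "d \<in> carrier A" using d(1) a_subset by blast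
    have "c \<odot>\<^bsub>A\<^esub> b \<in> I +>\<^bsub>A\<^esub> (c \<odot>\<^bsub>A\<^esub> a)"
      unfolding d(2) add[OF dc a] a_r_coset_def' by (rule UN_I[OF I[OF d(1)]]) (rule singletonI)
    then show ?thesis
      by (rule a_repr_independence[OF _ closed[OF a] a_subgroup, symmetric])
  qed
  moreover have "I +>\<^bsub>A\<^esub> a \<noteq> {}" using a_rcos_self[OF a] by (rule Set.ex_in_conv[THEN iffD1, OF exI])
  ultimately have "(\<Union>b \<in> I +>\<^bsub>A\<^esub> a. I +>\<^bsub>A\<^esub> (c \<odot>\<^bsub>A\<^esub> b)) = I +>\<^bsub>A\<^esub> (c \<odot>\<^bsub>A\<^esub> a)"
    by (intro SUP_eq_const) assumption+
  then show ?thesis by (simp add: quotient_algebra_def)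
qed

lemma semisimple_part_isomorphic:
  fixes A :: "('k::field, 'a, 'm) module_scheme"
  assumes "nil_kernel_onto_power A \<theta> r"
    and closed: "\<And>c a. a \<in> carrier A \<Longrightarrow> c \<odot>\<^bsub>A\<^esub> a \<in> carrier A"
    and add: "\<And>c a b. a \<in> carrier A \<Longrightarrow> b \<in> carrier A \<Longrightarrow>
      c \<odot>\<^bsub>A\<^esub> (a \<oplus>\<^bsub>A\<^esub> b) = c \<odot>\<^bsub>A\<^esub> a \<oplus>\<^bsub>A\<^esub> c \<odot>\<^bsub>A\<^esub> b"
    and smult: "\<And>c a. a \<in> carrier A \<Longrightarrow> \<theta> (c \<odot>\<^bsub>A\<^esub> a) = c \<odot>\<^bsub>power_algebra r\<^esub> \<theta> a"
  shows "algebra_isomorphic (semisimple_part A) (power_algebra r)"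
proof -
  interpret nil_kernel_onto_power A \<theta> r by fact
  let ?K = "a_kernel A (power_algebra r) \<theta>"
  let ?h = "\<lambda>X. the_elem (\<theta> ` X)"
  have S: "semisimple_part A = quotient_algebra A ?K"
    by (simp add: semisimple_part_def jacobson_radical_eq_kernel)
  have iso: "?h \<in> ring_iso (A Quot ?K) (power_algebra r)"
    using onto by (rule hom.FactRing_iso_set)
  have "?h (c \<odot>\<^bsub>quotient_algebra A ?K\<^esub> X) = c \<odot>\<^bsub>power_algebra r\<^esub> ?h X"
    if "X \<in> carrier (quotient_algebra A ?K)" for c X
  proof -
    have "X \<in> (\<Union>a\<in>carrier A. {?K +>\<^bsub>A\<^esub> a})"
      using that by (simp only: quotient_algebra_def FactRing_def A_RCOSETS_def' partial_object.simps)
    then obtain a where "a \<in> carrier A" "X \<in> {?K +>\<^bsub>A\<^esub> a}" by (rule UN_E)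
    then have a: "a \<in> carrier A" "X = ?K +>\<^bsub>A\<^esub> a" by simp_all
    have "c \<odot>\<^bsub>quotient_algebra A ?K\<^esub> X = ?K +>\<^bsub>A\<^esub> (c \<odot>\<^bsub>A\<^esub> a)"
      unfolding a(2)
    proof (rule quotient_algebra_smult[OF hom.kernel_is_ideal a(1) closed add])
      fix b assume "b \<in> ?K"
      then have "b \<in> carrier A" "\<theta> b = \<zero>\<^bsub>power_algebra r\<^esub>" unfolding a_kernel_def' by blast+
      then show "c \<odot>\<^bsub>A\<^esub> b \<in> ?K"
        using closed smult[of b c] unfolding a_kernel_def' by (simp cong: restrict_cong)
    qed
    moreover have "?h (?K +>\<^bsub>A\<^esub> (c \<odot>\<^bsub>A\<^esub> a)) = \<theta> (c \<odot>\<^bsub>A\<^esub> a)" "?h (?K +>\<^bsub>A\<^esub> a) = \<theta> a"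
      by (rule hom.the_elem_simp[OF closed[OF a(1)]], rule hom.the_elem_simp[OF a(1)])
    ultimately show ?thesis by (simp only: a(2) smult[OF a(1)])
  qed
  then have "?h \<in> algebra_hom (semisimple_part A) (power_algebra r)"
    using iso unfolding S algebra_hom_def ring_iso_def
    by (simp del: power_algebra_simps add: Ring.ring_hom_def quotient_algebra_def)
  moreover have "bij_betw ?h (carrier (semisimple_part A)) (carrier (power_algebra r))"
    using iso unfolding S ring_iso_def by (simp del: power_algebra_simps add: quotient_algebra_def)
  ultimately show ?thesis unfolding algebra_isomorphic_def by blast
qed

section \<open>Matrix representations\<close>

lemma ring_module_mat: "ring (module_mat TYPE('k::comm_ring_1) n n)"
  by (unfold_locales, insert add_inv_exists_mat)
     (auto simp: module_mat_def algebra_simps Units_def)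

locale matrix_representation = central_scalars \<kappa>
  for \<kappa> :: "'k::{alg_closed_field, field_char_0} \<Rightarrow> 'a::ring_1" +
  fixes n :: nat and \<pi> :: "'a \<Rightarrow> 'k mat"
  assumes \<pi>_carrier: "\<pi> a \<in> carrier_mat n n"
    and \<pi>_add: "\<pi> (a + b) = \<pi> a + \<pi> b"
    and \<pi>_mult: "\<pi> (a * b) = \<pi> a * \<pi> b"
    and \<pi>_1: "\<pi> 1 = 1\<^sub>m n"
    and \<pi>_smult: "\<pi> (\<kappa> c * a) = c \<cdot>\<^sub>m \<pi> a"
begin

lemma \<pi>_0: "\<pi> 0 = 0\<^sub>m n n"
proof -
  have "\<pi> 0 = 0 \<cdot>\<^sub>m \<pi> 0" using \<pi>_smult[of 0 0] by (simp add: \<kappa>_0)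
  also have "\<dots> = 0\<^sub>m n n" using \<pi>_carrier[of 0] by (intro eq_matI) auto
  finally show ?thesis .
qed

definition kernel :: "'a set" where
  "kernel = {a. \<pi> a = 0\<^sub>m n n}"

lemma \<pi>_eq_iff: "\<pi> a = \<pi> b \<longleftrightarrow> a - b \<in> kernel"
proof -
  have "\<pi> a = \<pi> (a - b) + \<pi> b" by (simp add: \<pi>_add[symmetric])
  moreover have "\<pi> a = \<pi> b" if "\<pi> a = M + \<pi> b" "M = 0\<^sub>m n n" for M
    using that \<pi>_carrier[of b] by simp
  moreover have "\<pi> (a - b) = 0\<^sub>m n n" if "\<pi> a = \<pi> b"
  proof -
    have "\<pi> (a - b) = \<pi> a + \<pi> (\<kappa> (- 1) * b)"
      by (simp add: \<pi>_add[symmetric] \<kappa>_uminus \<kappa>_1)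
    also have "\<dots> = 0\<^sub>m n n"
      unfolding \<pi>_smult that using \<pi>_carrier[of b] by (intro eq_matI) auto
    finally show ?thesis .
  qed
  ultimately show ?thesis unfolding kernel_def by blast
qed

lemma \<pi>_sum_entry:
  assumes "finite S" and "i < n" and "k < n"
  shows "\<pi> (\<Sum>j\<in>S. \<kappa> (c j) * b j) $$ (i, k) = (\<Sum>j\<in>S. c j * \<pi> (b j) $$ (i, k))"
  using assms(1)
proof induction
  case empty
  show ?case using assms by (simp add: \<pi>_0)
next
  case (insert j S)
  have "\<pi> (\<Sum>j\<in>insert j S. \<kappa> (c j) * b j) = c j \<cdot>\<^sub>m \<pi> (b j) + \<pi> (\<Sum>j\<in>S. \<kappa> (c j) * b j)"
    using insert.hyps by (simp add: \<pi>_add \<pi>_smult)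
  then show ?case
    using insert assms(2,3) \<pi>_carrier[of "b j"] \<pi>_carrier[of "\<Sum>j\<in>S. \<kappa> (c j) * b j"] by simp
qed

text \<open>The $n^2 + 1$ powers $1, z, \dots, z^{n^2}$ have linearly dependent images. To see this, their
  entries form the columns of a matrix with $n^2$ rows; a zero row makes it square and singular, and
  a vector in its null space holds the coefficients.\<close>
lemma annihilating_poly_exists: "\<exists>p. p \<noteq> 0 \<and> peval z p \<in> kernel"
proof -
  define N where "N = Suc (n * n)"
  define c where "c e = vec N (\<lambda>j. \<pi> (z ^ j) $$ (e div n, e mod n))" for e
  define M where "M = mat\<^sub>r N N (\<lambda>e. if e = n * n then 0\<^sub>v N else c e)"
  have M: "M \<in> carrier_mat N N" by (simp add: M_def mat_of_rows_def)
  have "det M = 0" unfolding M_def by (rule det_row_0) (auto simp: N_def c_def)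
  then obtain v where v: "v \<in> carrier_vec N" "v \<noteq> 0\<^sub>v N" "M *\<^sub>v v = 0\<^sub>v N"
    using det_0_iff_vec_prod_zero_field[OF M] by blast
  define p where "p = (\<Sum>j<N. Polynomial.monom (v $ j) j)"
  have coeff: "poly.coeff p j = v $ j" if "j < N" for j
    using that by (simp add: p_def coeff_sum)
  have "p \<noteq> 0"
  proof
    assume "p = 0"
    then have "v $ j = 0" if "j < N" for j using coeff[OF that] by simp
    then have "v = 0\<^sub>v N" using v(1) by (intro eq_vecI) auto
    then show False using v(2) by simp
  qed
  moreover have "\<pi> (peval z p) = 0\<^sub>m n n"
  proof (rule eq_matI)
    fix i k assume "i < dim_row (0\<^sub>m n n :: 'k mat)" "k < dim_col (0\<^sub>m n n :: 'k mat)"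
    then have ik: "i < n" "k < n" by simp_all
    define e where "e = i * n + k"
    have e: "e div n = i" "e mod n = k" using ik by (simp_all add: e_def)
    have "Suc i * n \<le> n * n" using ik by (intro mult_le_mono1) simp
    then have less: "e < n * n" using ik by (simp add: e_def)
    have "\<pi> (peval z p) $$ (i, k) = (\<Sum>j<N. v $ j * \<pi> (z ^ j) $$ (i, k))"
      using \<pi>_sum_entry[OF _ ik, of "{..<N}" "\<lambda>j. v $ j" "\<lambda>j. z ^ j"]
      by (simp add: p_def peval_sum peval_monom)
    also have "\<dots> = (M *\<^sub>v v) $ e"
      using less v(1) ik by (simp add: M_def N_def c_def e scalar_prod_def atLeast0LessThan mult.commute)
    also have "\<dots> = 0" using v(3) less by (simp add: N_def)
    finally show "\<pi> (peval z p) $$ (i, k) = 0\<^sub>m n n $$ (i, k)" using ik by simp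
  qed (use \<pi>_carrier[of "peval z p"] in auto)
  ultimately show ?thesis unfolding kernel_def by blast
qed

sublocale kernel: algebraic_quotient \<kappa> kernel
proof
  show "0 \<in> kernel" by (simp add: kernel_def \<pi>_0)
  show "a + b \<in> kernel" if "a \<in> kernel" "b \<in> kernel" for a b
    using that by (simp add: kernel_def \<pi>_add)
  show "b * a \<in> kernel" if "a \<in> kernel" for a b
    using that \<pi>_carrier[of b] by (simp add: kernel_def \<pi>_mult)
  show "a * b \<in> kernel" if "a \<in> kernel" for a b
    using that \<pi>_carrier[of b] by (simp add: kernel_def \<pi>_mult)
qed (rule annihilating_poly_exists)

lemma peval_mult_eigenvector:
  assumes v: "v \<in> carrier_vec n" and "\<pi> z *\<^sub>v v = c \<cdot>\<^sub>v v"
  shows "\<pi> (peval z p) *\<^sub>v v = poly p c \<cdot>\<^sub>v v"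
proof (induction p)
  case 0
  show ?case using v by (simp add: \<pi>_0) (auto intro!: eq_vecI)
next
  case (pCons a p)
  have "\<pi> (peval z (pCons a p)) = a \<cdot>\<^sub>m 1\<^sub>m n + \<pi> z * \<pi> (peval z p)"
    using \<pi>_smult[of a 1] by (simp add: \<pi>_add \<pi>_mult \<pi>_1)
  also have "\<dots> *\<^sub>v v = (a \<cdot>\<^sub>m 1\<^sub>m n) *\<^sub>v v + (\<pi> z * \<pi> (peval z p)) *\<^sub>v v"
    using \<pi>_carrier[of z] \<pi>_carrier[of "peval z p"] v by (intro add_mult_distrib_mat_vec[of _ n n]) auto
  also have "(\<pi> z * \<pi> (peval z p)) *\<^sub>v v = \<pi> z *\<^sub>v (poly p c \<cdot>\<^sub>v v)"
    using \<pi>_carrier[of z] \<pi>_carrier[of "peval z p"] v pCons.IH by (simp add: assoc_mult_mat_vec[of _ n n _ n])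
  also have "\<dots> = poly p c \<cdot>\<^sub>v (c \<cdot>\<^sub>v v)"
    using \<pi>_carrier[of z] v assms(2) by (simp add: mult_mat_vec[of _ n n])
  also have "(a \<cdot>\<^sub>m 1\<^sub>m n) *\<^sub>v v = a \<cdot>\<^sub>v v"
    using v by (intro eq_vecI) (auto simp: scalar_prod_left_unit)
  finally show ?case using v by (simp add: smult_smult_assoc add_smult_distrib_vec[symmetric] mult.commute)
qed

text \<open>For a root \<open>c\<close> write the minimal polynomial as $(t - c) g$. The matrix of $g(z)$ is not zero, by
  minimality, and each of its nonzero columns is an eigenvector for \<open>c\<close>.\<close>
lemma spectrum_eq_min_poly_roots: "spectrum (\<pi> z) = {c. poly (kernel.min_poly z) c = 0}"
proof (intro Set.set_eqI iffI)
  fix c assume "c \<in> spectrum (\<pi> z)"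
  then obtain v where v: "v \<in> carrier_vec n" "v \<noteq> 0\<^sub>v n" "\<pi> z *\<^sub>v v = c \<cdot>\<^sub>v v"
    using \<pi>_carrier[of z] by (auto simp: spectrum_def eigenvalue_def eigenvector_def)
  let ?f = "kernel.min_poly z"
  have "\<pi> (peval z ?f) = 0\<^sub>m n n" using kernel.peval_mem_iff[of z ?f] by (simp add: kernel_def)
  moreover have "0\<^sub>m n n *\<^sub>v v = 0\<^sub>v n" using v(1) by (intro eq_vecI) auto
  ultimately have "poly ?f c \<cdot>\<^sub>v v = 0\<^sub>v n" using peval_mult_eigenvector[OF v(1,3), of ?f] by simp
  moreover obtain i where "i < n" "v $ i \<noteq> 0"
  proof (atomize_elim, rule ccontr)
    assume "\<not> (\<exists>i. i < n \<and> v $ i \<noteq> 0)"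
    then have "v = 0\<^sub>v n" using v(1) by (intro eq_vecI) auto
    with v(2) show False ..
  qed
  ultimately have "poly ?f c * v $ i = 0" using v(1) by (metis carrier_vecD index_smult_vec(1) index_zero_vec(1))
  then show "c \<in> {c. poly ?f c = 0}" using \<open>v $ i \<noteq> 0\<close> by simp
next
  fix c assume "c \<in> {c. poly (kernel.min_poly z) c = 0}"
  then obtain g where g: "kernel.min_poly z = [:- c, 1:] * g" by (auto simp: poly_eq_0_iff_dvd)
  then have "g \<noteq> 0" using kernel.min_poly_nz[of z] by auto
  have "degree (kernel.min_poly z) = Suc (degree g)"
    using degree_mult_eq[of "[:- c, 1:]" g] \<open>g \<noteq> 0\<close> by (simp only: g) simp
  then have "\<not> kernel.min_poly z dvd g" using dvd_imp_degree_le[OF _ \<open>g \<noteq> 0\<close>] by fastforce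
  then have "\<pi> (peval z g) \<noteq> 0\<^sub>m n n" using kernel.peval_mem_iff[of z g] by (simp add: kernel_def)
  define G where "G = \<pi> (peval z g)"
  obtain i k where ik: "i < n" "k < n" "G $$ (i, k) \<noteq> 0"
  proof (atomize_elim, rule ccontr)
    assume "\<not> (\<exists>i k. i < n \<and> k < n \<and> G $$ (i, k) \<noteq> 0)"
    then have "\<pi> (peval z g) = 0\<^sub>m n n"
      using \<pi>_carrier[of "peval z g"] by (intro eq_matI) (auto simp: G_def)
    with \<open>\<pi> (peval z g) \<noteq> 0\<^sub>m n n\<close> show False ..
  qed
  have G: "G \<in> carrier_mat n n" unfolding G_def by (rule \<pi>_carrier)
  have "peval z [:- c, 1:] * peval z g \<in> kernel"
    using kernel.peval_mem_iff[of z "[:- c, 1:] * g"] by (simp only: g peval_mult dvd_refl)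
  moreover have "peval z [:- c, 1:] * peval z g = z * peval z g - \<kappa> c * peval z g"
    by (simp add: \<kappa>_uminus \<kappa>_1 algebra_simps)
  ultimately have "\<pi> (z * peval z g) = \<pi> (\<kappa> c * peval z g)" by (simp add: \<pi>_eq_iff)
  then have "\<pi> z * G = c \<cdot>\<^sub>m G" by (simp only: \<pi>_mult[of z] \<pi>_smult G_def)
  then have "\<pi> z *\<^sub>v col G k = c \<cdot>\<^sub>v col G k"
    using col_mult2[OF \<pi>_carrier G ik(2), of z] G ik(2) by simp
  moreover have "col G k \<noteq> 0\<^sub>v n" using ik G by (metis carrier_matD index_col index_zero_vec(1))
  ultimately show "c \<in> spectrum (\<pi> z)"
    using \<pi>_carrier[of z] col_carrier_vec[OF ik(2) G] unfolding spectrum_def eigenvalue_def eigenvector_def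
    by (intro CollectI exI[of _ "col G k"]) simp
qed

end

locale jordan_representation = matrix_representation \<kappa> n \<pi>
  for \<kappa> :: "'k::{alg_closed_field, field_char_0} \<Rightarrow> 'a::ring_1" and n \<pi> +
  fixes x y :: 'a
  assumes \<pi>_relation: "\<pi> (x * y - y * x - y ^ 2) = 0\<^sub>m n n"
    and generated: "\<lbrakk>\<And>c. \<kappa> c \<in> S; x \<in> S; y \<in> S; \<And>a b. a \<in> S \<Longrightarrow> b \<in> S \<Longrightarrow> a + b \<in> S;
      \<And>a b. a \<in> S \<Longrightarrow> b \<in> S \<Longrightarrow> a * b \<in> S\<rbrakk> \<Longrightarrow> S = UNIV"
begin

sublocale jordan_relation \<kappa> kernel x y
  by unfold_locales (use \<pi>_relation generated in \<open>auto simp: kernel_def\<close>)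

definition matrix_image :: "('k, 'k mat) module" where
  "matrix_image = (module_mat TYPE('k) n n)\<lparr>carrier := range \<pi>\<rparr>"

lemma matrix_image_simps [simp]:
  "carrier matrix_image = range \<pi>" "A \<otimes>\<^bsub>matrix_image\<^esub> B = A * B" "A \<oplus>\<^bsub>matrix_image\<^esub> B = A + B"
  "\<one>\<^bsub>matrix_image\<^esub> = 1\<^sub>m n" "\<zero>\<^bsub>matrix_image\<^esub> = 0\<^sub>m n n" "c \<odot>\<^bsub>matrix_image\<^esub> A = c \<cdot>\<^sub>m A"
  by (simp_all add: matrix_image_def module_mat_simps)

lemma ring_matrix_image: "ring matrix_image"
proof -
  interpret M: ring "module_mat TYPE('k) n n" by (rule ring_module_mat)
  have "subring (range \<pi>) (module_mat TYPE('k) n n)"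
  proof (rule M.subringI)
    fix B assume "B \<in> range \<pi>"
    then obtain b where b: "B = \<pi> b" by blast
    have "\<pi> (- b) \<oplus>\<^bsub>module_mat TYPE('k) n n\<^esub> B = \<zero>\<^bsub>module_mat TYPE('k) n n\<^esub>"
      by (simp add: b module_mat_simps \<pi>_add[symmetric] \<pi>_0)
    then have "\<ominus>\<^bsub>module_mat TYPE('k) n n\<^esub> B = \<pi> (- b)"
      using \<pi>_carrier by (intro M.minus_equality) (auto simp: b module_mat_simps)
    then show "\<ominus>\<^bsub>module_mat TYPE('k) n n\<^esub> B \<in> range \<pi>" by simp
  next
    show "\<one>\<^bsub>module_mat TYPE('k) n n\<^esub> \<in> range \<pi>"
      by (simp add: module_mat_simps \<pi>_1[symmetric])
  qed (use \<pi>_carrier in \<open>auto simp: module_mat_simps \<pi>_mult[symmetric] \<pi>_add[symmetric]\<close>)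
  then show ?thesis unfolding matrix_image_def by (rule M.subring_is_ring)
qed

lemma matrix_image_pow: "\<pi> a [^]\<^bsub>matrix_image\<^esub> (m::nat) = \<pi> (a ^ m)"
proof -
  interpret ring matrix_image by (rule ring_matrix_image)
  show ?thesis by (induction m) (simp_all add: \<pi>_1 \<pi>_mult[symmetric] power_Suc2 del: power_Suc)
qed

text \<open>The characters of the eigenvalues of \<open>\<pi> x\<close>, enumerated by \<open>e\<close>, are the coordinates of a map onto
  $k^r$. They vanish on \<open>kernel\<close>, so they are functions of the matrix \<open>\<pi> a\<close>.\<close>
theorem semisimple_part_matrix_image:
  "algebra_isomorphic (semisimple_part matrix_image) (power_algebra (card (spectrum (\<pi> x))))"
proof -
  define r where "r = card (spectrum (\<pi> x))"
  have "finite (spectrum (\<pi> x))"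
    unfolding spectrum_eq_min_poly_roots using kernel.min_poly_nz by (rule poly_roots_finite)
  then obtain e where e: "bij_betw e {..<r} (spectrum (\<pi> x))"
    using ex_bij_betw_nat_finite unfolding r_def lessThan_atLeast0 by blast
  have root: "poly (kernel.min_poly x) (e i) = 0" if "i < r" for i
    using bij_betwE[OF e] that by (auto simp: spectrum_eq_min_poly_roots)
  define \<theta> where "\<theta> A = (\<lambda>i\<in>{..<r}. char_val (e i) (SOME a. \<pi> a = A))" for A
  have \<theta>: "\<theta> (\<pi> a) = (\<lambda>i\<in>{..<r}. char_val (e i) a)" for a
  proof -
    define b where "b = (SOME b. \<pi> b = \<pi> a)"
    have "\<pi> b = \<pi> a" unfolding b_def by (rule someI[of _ a]) simp
    then have K: "b - a \<in> kernel" by (simp add: \<pi>_eq_iff)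
    have "char_val (e i) b = char_val (e i) a" if "i < r" for i
      using char_val_add[OF root[OF that], of "b - a" a] char_val_K[OF root[OF that] K] by simp
    then show ?thesis unfolding \<theta>_def b_def[symmetric] by (intro restrict_ext) simp
  qed
  interpret nil_kernel_onto_power matrix_image \<theta> r
  proof (intro nil_kernel_onto_power.intro nil_kernel_onto_power_axioms.intro)
    show "ring matrix_image" by (rule ring_matrix_image)
    show "\<theta> \<in> Ring.ring_hom matrix_image (power_algebra r)"
    proof (rule ring_hom_memI)
      show "\<theta> \<one>\<^bsub>matrix_image\<^esub> = \<one>\<^bsub>power_algebra r\<^esub>"
        using char_val_\<kappa>[OF root, of _ 1]
        by (simp add: \<pi>_1[symmetric] \<theta> \<kappa>_1 cong: restrict_cong)
    next
      fix A B assume "A \<in> carrier matrix_image" "B \<in> carrier matrix_image"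
      then obtain a b where ab: "A = \<pi> a" "B = \<pi> b" by auto
      show "\<theta> (A \<otimes>\<^bsub>matrix_image\<^esub> B) = \<theta> A \<otimes>\<^bsub>power_algebra r\<^esub> \<theta> B"
        by (simp add: ab \<pi>_mult[symmetric] \<theta> char_val_mult[OF root] cong: restrict_cong)
      show "\<theta> (A \<oplus>\<^bsub>matrix_image\<^esub> B) = \<theta> A \<oplus>\<^bsub>power_algebra r\<^esub> \<theta> B"
        by (simp add: ab \<pi>_add[symmetric] \<theta> char_val_add[OF root] cong: restrict_cong)
    next
      show "\<theta> A \<in> carrier (power_algebra r)" for A by (simp add: \<theta>_def)
    qed
    show "\<theta> ` carrier matrix_image = carrier (power_algebra r)"
    proof
      show "\<theta> ` carrier matrix_image \<subseteq> carrier (power_algebra r)"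
        by (simp add: image_subset_iff \<theta>_def)
      show "carrier (power_algebra r) \<subseteq> \<theta> ` carrier matrix_image"
      proof
        fix g :: "nat \<Rightarrow> 'k" assume g: "g \<in> carrier (power_algebra r)"
        obtain p where p: "\<forall>c\<in>spectrum (\<pi> x). poly p c = g (inv_into {..<r} e c)"
          using interpolating_poly[OF \<open>finite (spectrum (\<pi> x))\<close>, of "\<lambda>c. g (inv_into {..<r} e c)"] by blast
        have "poly p (e i) = g i" if "i < r" for i
          using p e that bij_betwE[OF e] by (simp add: bij_betw_def inv_into_f_f)
        then have "\<theta> (\<pi> (peval x p)) = g"
          using g by (simp add: \<theta> char_val_peval[OF root] PiE_restrict cong: restrict_cong)
        then show "g \<in> \<theta> ` carrier matrix_image" by (metis image_eqI matrix_image_simps(1) rangeI)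
      qed
    qed
    show "\<exists>m::nat. A [^]\<^bsub>matrix_image\<^esub> m = \<zero>\<^bsub>matrix_image\<^esub>"
      if A: "A \<in> carrier matrix_image" and 0: "\<theta> A = \<zero>\<^bsub>power_algebra r\<^esub>" for A
    proof -
      obtain a where a: "A = \<pi> a" using A by auto
      have "char_val c a = 0" if c: "poly (kernel.min_poly x) c = 0" for c
      proof -
        obtain i where "i < r" "c = e i"
          using c e by (auto simp: spectrum_eq_min_poly_roots bij_betw_def)
        then show ?thesis using fun_cong[OF 0, of i] by (simp add: a \<theta>)
      qed
      then obtain m where "a ^ m \<in> kernel" using char_val_nil by blast
      then show ?thesis by (auto simp: a matrix_image_pow kernel_def)
    qed
  qed
  show ?thesis unfolding r_def[symmetric]
  proof (rule semisimple_part_isomorphic[OF nil_kernel_onto_power_axioms])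
    fix c A assume "A \<in> carrier matrix_image"
    then obtain a where a: "A = \<pi> a" by auto
    show "c \<odot>\<^bsub>matrix_image\<^esub> A \<in> carrier matrix_image" by (simp add: a \<pi>_smult[symmetric])
    show "\<theta> (c \<odot>\<^bsub>matrix_image\<^esub> A) = c \<odot>\<^bsub>power_algebra r\<^esub> \<theta> A"
      by (simp add: a \<pi>_smult[symmetric] \<theta> char_val_mult[OF root] char_val_\<kappa>[OF root] cong: restrict_cong)
    fix B assume "B \<in> carrier matrix_image"
    then obtain b where b: "B = \<pi> b" by auto
    show "c \<odot>\<^bsub>matrix_image\<^esub> (A \<oplus>\<^bsub>matrix_image\<^esub> B) = c \<odot>\<^bsub>matrix_image\<^esub> A \<oplus>\<^bsub>matrix_image\<^esub> c \<odot>\<^bsub>matrix_image\<^esub> B"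
      using add_smult_distrib_left_mat[OF \<pi>_carrier \<pi>_carrier] by (simp add: a b)
  qed
qed

end

section \<open>Quotients of free algebras\<close>

definition scalar :: "'k::field \<Rightarrow> ('g free_monoid \<Rightarrow>\<^sub>0 'k)" where
  "scalar c = Poly_Mapping.single 0 c"

lemma poly_mapping_single_add_induct [case_names single add]:
  assumes "\<And>k c. P (Poly_Mapping.single k c)" and "\<And>f g. P f \<Longrightarrow> P g \<Longrightarrow> P (f + g)"
  shows "P f"
proof (induction f rule: Poly_Mapping.update_induct)
  case const
  show ?case using assms(1)[of undefined 0] by simp
next
  case (update f a b)
  have "Poly_Mapping.update a b f = f + Poly_Mapping.single a b"
    using update.hyps(1)
    by (intro poly_mapping_eqI) (auto simp: lookup_update lookup_add lookup_single when_def in_keys_iff)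
  then show ?case using assms update.IH by simp
qed

interpretation scalar: central_scalars scalar
proof
  fix c d :: "'k::field"
  show "scalar (c + d) = (scalar c + scalar d :: 'g free_monoid \<Rightarrow>\<^sub>0 'k)"
    by (simp add: scalar_def single_add)
  show "scalar (c * d) = (scalar c * scalar d :: 'g free_monoid \<Rightarrow>\<^sub>0 'k)"
    by (simp add: scalar_def mult_single)
  show "scalar 1 = (1 :: 'g free_monoid \<Rightarrow>\<^sub>0 'k)" by (simp add: scalar_def)
  show "a * scalar c = scalar c * a" for a :: "'g free_monoid \<Rightarrow>\<^sub>0 'k"
    by (induction a rule: poly_mapping_single_add_induct)
       (simp_all add: scalar_def mult_single mult.commute distrib_left distrib_right)
qed

lemma free_algebra_generated:
  fixes S :: "('g free_monoid \<Rightarrow>\<^sub>0 'k::field) set"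
  assumes "\<And>c. scalar c \<in> S" and "\<And>g. free_gen g \<in> S"
    and "\<And>a b. a \<in> S \<Longrightarrow> b \<in> S \<Longrightarrow> a + b \<in> S" and "\<And>a b. a \<in> S \<Longrightarrow> b \<in> S \<Longrightarrow> a * b \<in> S"
  shows "S = UNIV"
proof -
  have word: "Poly_Mapping.single (Word u) 1 \<in> S" for u
  proof (induction u)
    case Nil
    then show ?case using assms(1)[of 1] by (simp add: scalar_def zero_free_monoid_def)
  next
    case (Cons g u)
    have "Poly_Mapping.single (Word (g # u)) 1 = free_gen g * (Poly_Mapping.single (Word u) 1 :: 'g free_monoid \<Rightarrow>\<^sub>0 'k)"
      by (simp add: free_gen_def mult_single)
    then show ?case using Cons assms(2,4) by simp
  qed
  have "a \<in> S" for a
  proof (induction a rule: poly_mapping_single_add_induct)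
    case (single k c)
    obtain u where "k = Word u" by (cases k)
    then have "Poly_Mapping.single k c = scalar c * Poly_Mapping.single (Word u) 1"
      by (simp add: scalar_def mult_single)
    then show ?case using assms(1,4) word by simp
  qed (rule assms(3))
  then show ?thesis by blast
qed

lemma free_algebra_simps [simp]:
  "carrier free_algebra = UNIV" "a \<otimes>\<^bsub>free_algebra\<^esub> b = a * b" "a \<oplus>\<^bsub>free_algebra\<^esub> b = a + b"
  "\<one>\<^bsub>free_algebra\<^esub> = 1" "\<zero>\<^bsub>free_algebra\<^esub> = 0" "c \<odot>\<^bsub>free_algebra\<^esub> a = scalar c * a"
  by (simp_all add: free_algebra_def scalar_def)

lemma ring_free_algebra: "ring (free_algebra :: ('k::field, 'g free_monoid \<Rightarrow>\<^sub>0 'k) module)" (is "ring ?F")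
proof (rule ringI)
  show "abelian_group ?F"
    by (rule abelian_groupI) (auto simp: ac_simps intro: exI[of _ "- x" for x])
  show "Group.monoid ?F" by (rule Group.monoidI) (simp_all add: mult.assoc)
qed (simp_all add: algebra_simps)

text \<open>A representation of a quotient of the free algebra, turned into a map on the free algebra itself by
  composing with \<open>coset\<close>.\<close>
locale free_quotient_hom =
  fixes I :: "('g free_monoid \<Rightarrow>\<^sub>0 'k::field) set" and n :: nat
    and \<rho> :: "('g free_monoid \<Rightarrow>\<^sub>0 'k) set \<Rightarrow> 'k mat"
  assumes ideal: "ideal I (free_algebra :: ('k, 'g free_monoid \<Rightarrow>\<^sub>0 'k) module)"
    and rep: "\<rho> \<in> representations (quotient_algebra free_algebra I) n"
begin

abbreviation coset :: "('g free_monoid \<Rightarrow>\<^sub>0 'k) \<Rightarrow> ('g free_monoid \<Rightarrow>\<^sub>0 'k) set" where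
  "coset a \<equiv> I +>\<^bsub>free_algebra :: ('k, 'g free_monoid \<Rightarrow>\<^sub>0 'k) module\<^esub> a"

abbreviation Q :: "('k, ('g free_monoid \<Rightarrow>\<^sub>0 'k) set) module" where
  "Q \<equiv> quotient_algebra free_algebra I"

interpretation ideal I "free_algebra :: ('k, 'g free_monoid \<Rightarrow>\<^sub>0 'k) module" by (rule ideal)

lemma carrier_quotient: "carrier Q = range coset"
  by (simp only: quotient_algebra_def FactRing_def A_RCOSETS_def' partial_object.simps free_algebra_simps) blast

lemma coset_smult: "c \<odot>\<^bsub>Q\<^esub> coset a = coset (scalar c * a)"
  using quotient_algebra_smult[OF ideal, of a c] I_l_closed by (simp add: distrib_left)

lemma rep_hom: "\<rho> \<in> Ring.ring_hom Q (module_mat TYPE('k) n n)"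
  and rep_smult: "A \<in> carrier Q \<Longrightarrow> \<rho> (c \<odot>\<^bsub>Q\<^esub> A) = c \<odot>\<^bsub>module_mat TYPE('k) n n\<^esub> \<rho> A"
  using rep by (simp_all add: representations_def algebra_hom_def)

lemma
  shows rep_coset_carrier: "\<rho> (coset a) \<in> carrier_mat n n"
    and rep_coset_add: "\<rho> (coset (a + b)) = \<rho> (coset a) + \<rho> (coset b)"
    and rep_coset_mult: "\<rho> (coset (a * b)) = \<rho> (coset a) * \<rho> (coset b)"
    and rep_coset_one: "\<rho> (coset 1) = 1\<^sub>m n"
    and rep_coset_smult: "\<rho> (coset (scalar c * a)) = c \<cdot>\<^sub>m \<rho> (coset a)"
proof -
  have mem: "coset a \<in> carrier Q" for a unfolding carrier_quotient by blast
  show "\<rho> (coset a) \<in> carrier_mat n n"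
    using ring_hom_closed[OF rep_hom mem] by (simp add: module_mat_simps)
  have "coset (a + b) = coset a \<oplus>\<^bsub>Q\<^esub> coset b"
    using a_rcos_sum[of a b] by (simp add: quotient_algebra_def FactRing_def)
  then show "\<rho> (coset (a + b)) = \<rho> (coset a) + \<rho> (coset b)"
    using ring_hom_add[OF rep_hom mem mem] by (simp add: module_mat_simps)
  have "coset (a * b) = coset a \<otimes>\<^bsub>Q\<^esub> coset b"
    using rcoset_mult_add[of a b] by (simp add: quotient_algebra_def FactRing_def)
  then show "\<rho> (coset (a * b)) = \<rho> (coset a) * \<rho> (coset b)"
    using ring_hom_mult[OF rep_hom mem mem] by (simp add: module_mat_simps)
  have "coset 1 = \<one>\<^bsub>Q\<^esub>" by (simp add: quotient_algebra_def FactRing_def)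
  then show "\<rho> (coset 1) = 1\<^sub>m n"
    using ring_hom_one[OF rep_hom] by (simp add: module_mat_simps)
  show "\<rho> (coset (scalar c * a)) = c \<cdot>\<^sub>m \<rho> (coset a)"
    using rep_smult[OF mem, of c a] by (simp only: coset_smult module_mat_simps)
qed

lemma rep_coset_ideal:
  assumes "a \<in> I"
  shows "\<rho> (coset a) = 0\<^sub>m n n"
proof -
  have "coset a = coset (scalar 0 * a)"
    using a_coset_join2[OF _ a_subgroup, of a] a_coset_add_zero[OF a_subset] assms
    by (simp add: scalar.\<kappa>_0)
  then have "\<rho> (coset a) = \<rho> (coset (scalar 0 * a))" by (rule arg_cong)
  also have "\<dots> = 0 \<cdot>\<^sub>m \<rho> (coset a)" by (rule rep_coset_smult)
  also have "\<dots> = 0\<^sub>m n n" using rep_coset_carrier[of a] by (intro eq_matI) auto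
  finally show ?thesis .
qed

end

section \<open>Representations of $k\langle x, y\rangle / (xy - yx - y^2)$\<close>

theorem mainTheorem10:
  fixes n :: nat
    and \<rho> :: "(xy free_monoid \<Rightarrow>\<^sub>0 'k::{alg_closed_field, field_char_0}) set \<Rightarrow> 'k mat"
  assumes "n \<ge> 1"
    and "\<rho> \<in> representations jordan_algebra n"
  defines "A \<equiv> image_algebra jordan_algebra (module_mat TYPE('k) n n) \<rho>"
    and "r \<equiv> card (spectrum (\<rho> jordan_x))"
  shows "basic_algebra A \<and> algebra_isomorphic (semisimple_part A) (power_algebra r)"
proof -
  let ?X = "free_gen GenX :: xy free_monoid \<Rightarrow>\<^sub>0 'k" and ?Y = "free_gen GenY :: xy free_monoid \<Rightarrow>\<^sub>0 'k"
  let ?\<pi> = "\<lambda>a. \<rho> (jordan_ideal +>\<^bsub>free_algebra :: ('k, xy free_monoid \<Rightarrow>\<^sub>0 'k) module\<^esub> a)"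
  interpret free: ring "free_algebra :: ('k, xy free_monoid \<Rightarrow>\<^sub>0 'k) module"
    by (rule ring_free_algebra)
  interpret rep: free_quotient_hom "jordan_ideal :: (xy free_monoid \<Rightarrow>\<^sub>0 'k) set" n \<rho>
    using assms(2) free.genideal_ideal
    by (intro free_quotient_hom.intro) (simp_all add: jordan_ideal_def jordan_algebra_def)
  have relation: "?X * ?Y - ?Y * ?X - ?Y ^ 2 \<in> jordan_ideal"
    unfolding jordan_ideal_def by (rule free.genideal_self') simp
  interpret jordan_representation scalar n ?\<pi> ?X ?Y
  proof
    show "?\<pi> (?X * ?Y - ?Y * ?X - ?Y ^ 2) = 0\<^sub>m n n" by (rule rep.rep_coset_ideal[OF relation])
  next
    fix S :: "(xy free_monoid \<Rightarrow>\<^sub>0 'k) set"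
    assume S: "\<And>c. scalar c \<in> S" "?X \<in> S" "?Y \<in> S"
      "\<And>a b. a \<in> S \<Longrightarrow> b \<in> S \<Longrightarrow> a + b \<in> S" "\<And>a b. a \<in> S \<Longrightarrow> b \<in> S \<Longrightarrow> a * b \<in> S"
    have "free_gen g \<in> S" for g using S(2,3) by (cases g) simp_all
    with S show "S = UNIV" by (intro free_algebra_generated)
  qed (rule rep.rep_coset_carrier rep.rep_coset_add rep.rep_coset_mult rep.rep_coset_one rep.rep_coset_smult)+
  have "A = matrix_image"
    unfolding A_def image_algebra_def matrix_image_def jordan_algebra_def rep.carrier_quotient
    by (simp add: image_image)
  then have "algebra_isomorphic (semisimple_part A) (power_algebra r)"
    using semisimple_part_matrix_image by (simp add: r_def jordan_x_def)
  then show ?thesis by (auto simp: basic_algebra_def)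
qed

end
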